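(* Let $G$ be a finite connected chordal graph and let $\omega(G)$ denote its clique number. Then there exists a set $F \subseteq V(G)$ with $|F| \leq 4\lceil \omega(G)/5 \rceil$ such that $F$ intersects (the vertex set of) every detour of $G$. Moreover, $F$ can be chosen so that it induces a clique in $G$.
   Context: A graph is chordal if every cycle on four or more vertices has a chord (equivalently, its only induced cycles are triangles). A detour of $G$ is a longest path of $G$, i.e. a path with the maximum number of vertices among all paths in $G$. A set of vertices is a transversal of the detours if it contains at least one vertex of every detour. *)

theory Defs
  imports Complex_Main "Graph_Theory.Digraph_Component" "Graph_Theory.Vertex_Walk"
begin

text \<open>
  A finite simple graph is a \<^locale>\<open>pair_graph\<close>: each undirected edge is represented by the two
  arcs \<open>(u, v)\<close> and \<open>(v, u)\<close>, and there are no loops.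
\<close>

text \<open>
  A cycle is given by its list of arcs. Hence \<open>length c\<close> is its number of vertices, its vertex set
  is \<open>fst ` set c\<close>, and an edge of \<open>G\<close> lies on it iff one of its two arcs does.
  The library's cycles include the degenerate \<open>u, v, u\<close>, but a cycle with at least
  three arcs is a cycle of the underlying undirected graph.
\<close>
definition chord :: "'a pair_pre_digraph \<Rightarrow> ('a \<times> 'a) awalk \<Rightarrow> 'a \<times> 'a \<Rightarrow> bool" where
  "chord G c e \<longleftrightarrow> e \<in> parcs G \<and> fst e \<in> fst ` set c \<and> snd e \<in> fst ` set c
     \<and> (fst e, snd e) \<notin> set c \<and> (snd e, fst e) \<notin> set c"

definition chordal :: "'a pair_pre_digraph \<Rightarrow> bool" where
  "chordal G \<longleftrightarrow>
     (\<forall>c. pre_digraph.cycle (with_proj G) c \<and> 4 \<le> length c \<longrightarrow> (\<exists>e. chord G c e))"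

definition clique :: "'a pair_pre_digraph \<Rightarrow> 'a set \<Rightarrow> bool" where
  "clique G K \<longleftrightarrow> K \<subseteq> pverts G \<and> (\<forall>u\<in>K. \<forall>v\<in>K. u \<noteq> v \<longrightarrow> (u, v) \<in> parcs G)"

definition clique_number :: "'a pair_pre_digraph \<Rightarrow> nat" where
  "clique_number G = Max {card K | K. clique G K}"

definition detour :: "'a pair_pre_digraph \<Rightarrow> 'a vwalk \<Rightarrow> bool" where
  "detour G p \<longleftrightarrow>
     vpath p (with_proj G) \<and> (\<forall>q. vpath q (with_proj G) \<longrightarrow> length q \<le> length p)"

definition detour_transversal :: "'a pair_pre_digraph \<Rightarrow> 'a set \<Rightarrow> bool" where
  "detour_transversal G F \<longleftrightarrow> F \<subseteq> pverts G \<and> (\<forall>p. detour G p \<longrightarrow> F \<inter> set p \<noteq> {})"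

end

theory Submission
  imports Defs
begin

text \<open>
  Let \<open>m = \<lceil>\<omega>(G)/5\<rceil>\<close> and suppose that every clique with at most \<open>4m\<close> vertices misses some detour.
  Colour a clique \<open>B\<close> with five colours so that each class has at most \<open>m\<close> vertices; then for every
  colour \<open>i\<close> some detour \<open>P\<^sub>i\<close> meets \<open>B\<close> in colour \<open>i\<close> only. If each \<open>P\<^sub>i\<close> meets \<open>B\<close>, exchanging the parts
  of \<open>P\<^sub>i\<close> and \<open>P\<^sub>j\<close> inside a union of components of \<open>G - B\<close>, and rejoining the pieces through edges of \<open>B\<close>,
  gains length in total, because each new path keeps the vertices of \<open>B\<close> on both old ones. Hence at most one
  \<open>P\<^sub>i\<close> has its ends in different components of \<open>G - B\<close>, three of the other four have all their ends in
  one component \<open>C\<close>, and two of these three stay inside \<open>C \<union> B\<close>: the clique \<open>B\<close> points to \<open>C\<close>.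

  Starting from \<open>B = {}\<close> and \<open>C = V(G)\<close>, chordality yields a vertex \<open>v \<in> C\<close> adjacent to all of
  \<open>N(C) \<subseteq> B\<close>. The clique \<open>N(C) \<union> {v}\<close>, coloured consistently, points to a component that is either
  strictly inside \<open>C\<close>, and the argument is repeated, or disjoint from \<open>C\<close>. In the latter case two detours of
  different colours, one on each side of \<open>N(C)\<close>, are disjoint, which is impossible in a connected graph.
\<close>

section \<open>Lists, arcs and colourings\<close>

lemma hd_append_Cons: "hd (a @ x # b) = (if a = [] then x else hd a)"
  by (cases a) auto

lemma pawalk_verts_vwalk_arcs:
  "c \<noteq> [] \<Longrightarrow> pawalk_verts u (vwalk_arcs c @ [(last c, z)]) = c @ [z]"
  by (induct c arbitrary: u rule: vwalk_arcs.induct) auto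

lemma pcas_vwalk_arcs:
  "c \<noteq> [] \<Longrightarrow> pcas (hd c) (vwalk_arcs c @ [(last c, z)]) z"
  by (induct c rule: vwalk_arcs.induct) auto

lemma fst_vwalk_arcs: "c \<noteq> [] \<Longrightarrow> fst ` set (vwalk_arcs c @ [(last c, z)]) = set c"
  by (induct c rule: vwalk_arcs.induct) auto

lemma length_vwalk_arcs: "c \<noteq> [] \<Longrightarrow> length (vwalk_arcs c @ [(last c, z)]) = length c"
  by (induct c rule: vwalk_arcs.induct) auto

lemma in_vwalk_arcs: "(u, v) \<in> set (vwalk_arcs (a @ u # v # b))"
  by (induct a rule: vwalk_arcs.induct) auto

text \<open>To be applied to four detours, \<open>C i\<close> being the component that holds both
  ends of the i-th and \<open>M i X\<close> saying that it enters \<open>X\<close>. If the four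
  classes are all different, the six pairs yield six distinct entries, but each class admits only
  one.\<close>

lemma three_in_common_class:
  assumes "card D = 4"
    and M: "\<And>i j. i \<in> D \<Longrightarrow> j \<in> D \<Longrightarrow> i \<noteq> j \<Longrightarrow> C i \<noteq> C j \<Longrightarrow> M i (C j) \<or> M j (C i)"
    and uniq: "\<And>i j k. i \<in> D \<Longrightarrow> j \<in> D \<Longrightarrow> k \<in> D \<Longrightarrow> i \<noteq> j \<Longrightarrow> C i \<noteq> C k \<Longrightarrow> C j \<noteq> C k
      \<Longrightarrow> M i (C k) \<Longrightarrow> M j (C k) \<Longrightarrow> False"
  shows "\<exists>x\<in>D. \<exists>y\<in>D. \<exists>z\<in>D. x \<noteq> y \<and> y \<noteq> z \<and> x \<noteq> z \<and> C x = C y \<and> C y = C z"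
proof -
  \<comment> \<open>If \<open>C i = C j\<close> and neither \<open>k\<close> nor \<open>l\<close>
    lies in that class, then \<open>i\<close> and \<open>j\<close> cannot both enter
    \<open>C k\<close>, so \<open>k\<close> enters \<open>C i\<close>. In the same way
    \<open>l\<close> enters \<open>C i\<close>, and two entries are one too many. The case
    \<open>C k = C l\<close> is covered.\<close>
  have pair: ?thesis
    if D: "i \<in> D" "j \<in> D" "k \<in> D" "l \<in> D" and "i \<noteq> j" "i \<noteq> k" "i \<noteq> l" "j \<noteq> k" "j \<noteq> l" "k \<noteq> l"
      and "C i = C j" for i j k l
  proof (rule ccontr)
    assume "\<not> ?thesis"
    then have "C i \<noteq> C k" "C i \<noteq> C l"
      using that by metis+
    then have "M i (C k) \<or> M k (C i)" "M j (C k) \<or> M k (C i)" "M i (C l) \<or> M l (C i)" "M j (C l) \<or> M l (C i)"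
      using M[of i k] M[of j k] M[of i l] M[of j l] that by auto
    moreover have "\<not> (M k (C i) \<and> M l (C i))" "\<not> (M i (C k) \<and> M j (C k))" "\<not> (M i (C l) \<and> M j (C l))"
      using uniq[of k l i] uniq[of i j k] uniq[of i j l] that \<open>C i \<noteq> C k\<close> \<open>C i \<noteq> C l\<close> by auto
    ultimately show False
      by argo
  qed
  obtain a b c d where D: "a \<in> D" "b \<in> D" "c \<in> D" "d \<in> D"
    and dist: "a \<noteq> b" "a \<noteq> c" "a \<noteq> d" "b \<noteq> c" "b \<noteq> d" "c \<noteq> d"
    using assms(1) by (auto simp: card_Suc_eq numeral_eq_Suc)
  show ?thesis
  proof (cases "C a = C b \<or> C a = C c \<or> C a = C d \<or> C b = C c \<or> C b = C d \<or> C c = C d")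
    case True
    then show ?thesis
      using pair[OF D(1,2,3,4) dist(1) dist(2) dist(3) dist(4) dist(5) dist(6)]
        pair[OF D(1,3,2,4) dist(2) dist(1) dist(3) dist(4)[symmetric] dist(6) dist(5)]
        pair[OF D(1,4,2,3) dist(3) dist(1) dist(2) dist(5)[symmetric] dist(6)[symmetric] dist(4)]
        pair[OF D(2,3,1,4) dist(4) dist(1)[symmetric] dist(5) dist(2)[symmetric] dist(6) dist(3)]
        pair[OF D(2,4,1,3) dist(5) dist(1)[symmetric] dist(4) dist(3)[symmetric] dist(6)[symmetric] dist(2)]
        pair[OF D(3,4,1,2) dist(6) dist(2)[symmetric] dist(4)[symmetric] dist(3)[symmetric] dist(5)[symmetric] dist(1)]
      by argo
  next
    case False
    then have ne: "C a \<noteq> C b" "C a \<noteq> C c" "C a \<noteq> C d" "C b \<noteq> C c" "C b \<noteq> C d" "C c \<noteq> C d"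
      by auto
    have single: "\<not> (M i (C k) \<and> M j (C k))"
      if "i \<in> D" "j \<in> D" "k \<in> D" "i \<noteq> j" "C i \<noteq> C k" "C j \<noteq> C k" for i j k
      using uniq[OF that] by blast
    show ?thesis
      using M[OF D(1,2) dist(1) ne(1)] M[OF D(1,3) dist(2) ne(2)]
        M[OF D(1,4) dist(3) ne(3)] M[OF D(2,3) dist(4) ne(4)]
        M[OF D(2,4) dist(5) ne(5)] M[OF D(3,4) dist(6) ne(6)]
        single[OF D(2,3,1) dist(4) ne(1)[symmetric] ne(2)[symmetric]] single[OF D(2,4,1) dist(5) ne(1)[symmetric] ne(3)[symmetric]]
        single[OF D(3,4,1) dist(6) ne(2)[symmetric] ne(3)[symmetric]] single[OF D(1,3,2) dist(2) ne(1) ne(4)[symmetric]]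
        single[OF D(1,4,2) dist(3) ne(1) ne(5)[symmetric]] single[OF D(3,4,2) dist(6) ne(4)[symmetric] ne(5)[symmetric]]
        single[OF D(1,2,3) dist(1) ne(2) ne(4)] single[OF D(1,4,3) dist(3) ne(2) ne(6)[symmetric]]
        single[OF D(2,4,3) dist(5) ne(4) ne(6)[symmetric]] single[OF D(1,2,4) dist(1) ne(3) ne(5)]
        single[OF D(1,3,4) dist(2) ne(3) ne(6)] single[OF D(2,3,4) dist(4) ne(5) ne(6)]
      by argo
  qed
qed

section \<open>Balanced colourings\<close>

lemma card_le_colour_classes:
  fixes c :: "'b \<Rightarrow> nat"
  assumes "finite A" "\<forall>b\<in>A. c b < n" "\<forall>i<n. card {b \<in> A. c b = i} \<le> m" "I \<subseteq> {..<n}"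
    and "S \<subseteq> A" "\<forall>b\<in>S. c b \<in> I"
  shows "card S \<le> card I * m"
proof -
  have fI: "finite I"
    using assms(4) finite_subset by blast
  have "card S \<le> card (\<Union>i\<in>I. {b \<in> A. c b = i})"
    by (rule card_mono) (use assms fI in auto)
  also have "\<dots> \<le> (\<Sum>i\<in>I. card {b \<in> A. c b = i})"
    by (rule card_UN_le[OF fI])
  also have "\<dots> \<le> card I * m"
    using sum_bounded_above[of I "\<lambda>i. card {b \<in> A. c b = i}" m] assms(3,4) by auto
  finally show ?thesis .
qed

text \<open>By counting, some class is not yet full, and \<open>v\<close> goes there. The old
  colours are kept so that detours found for a clique can be compared with those found for its
  extension.\<close>

lemma extend_colouring:
  fixes c :: "'b \<Rightarrow> nat"
  assumes "finite A" "v \<notin> A" "card (insert v A) \<le> n * m"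
    and "\<forall>b\<in>A. c b < n" "\<forall>i<n. card {b \<in> A. c b = i} \<le> m"
  obtains c' where "\<forall>b\<in>insert v A. c' b < n" "\<forall>i<n. card {b \<in> insert v A. c' b = i} \<le> m"
    and "\<forall>b\<in>A. c' b = c b"
proof -
  have "\<exists>k<n. card {b \<in> A. c b = k} < m"
  proof (rule ccontr)
    assume "\<not> ?thesis"
    then have "card {b \<in> A. c b = k} = m" if "k < n" for k
      using that assms(5) by (meson le_neq_implies_less)
    then have "n * m = (\<Sum>k<n. card {b \<in> A. c b = k})"
      by simp
    also have "\<dots> = card (\<Union>k<n. {b \<in> A. c b = k})"
      by (rule card_UN_disjoint[symmetric]) (use assms(1) in auto)
    also have "\<dots> \<le> card A"
      by (rule card_mono) (use assms(1) in auto)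
    finally show False
      using assms(1-3) by simp
  qed
  then obtain k where k: "k < n" "card {b \<in> A. c b = k} < m"
    by blast
  define c' where "c' = c(v := k)"
  have "{b \<in> insert v A. c' b = k} = insert v {b \<in> A. c b = k}"
    using assms(2) by (auto simp: c'_def)
  moreover have "{b \<in> insert v A. c' b = i} = {b \<in> A. c b = i}" if "i \<noteq> k" for i
    using that assms(2) by (auto simp: c'_def)
  ultimately have "card {b \<in> insert v A. c' b = i} \<le> m" if "i < n" for i
    using that k(2) assms(1,2,5) by (cases "i = k") auto
  moreover have "\<forall>b\<in>insert v A. c' b < n" "\<forall>b\<in>A. c' b = c b"
    using assms(2,4) k(1) by (auto simp: c'_def)
  ultimately show thesis
    using that[of c'] by blast
qed

context pair_graph
begin

section \<open>Exchanging parts of detours\<close>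

abbreviation adj :: "'a \<Rightarrow> 'a \<Rightarrow> bool" where
  "adj u v \<equiv> (u, v) \<in> parcs G"

definition reach_in :: "'a set \<Rightarrow> 'a \<Rightarrow> 'a \<Rightarrow> bool" where
  "reach_in A = (\<lambda>x y. adj x y \<and> x \<in> A \<and> y \<in> A)\<^sup>*\<^sup>*"

definition connected_in :: "'a set \<Rightarrow> bool" where
  "connected_in A \<longleftrightarrow> (\<forall>x\<in>A. \<forall>y\<in>A. reach_in A x y)"

text \<open>For \<open>X \<subseteq> pverts G\<close> this says that \<open>X\<close> is a union of
  components of \<open>G - B\<close>. In this form unions of such sets need no bookkeeping of
  components.\<close>

definition cut_off :: "'a set \<Rightarrow> 'a set \<Rightarrow> bool" where
  "cut_off B X \<longleftrightarrow> X \<inter> B = {} \<and> (\<forall>x\<in>X. \<forall>y. adj x y \<longrightarrow> y \<in> X \<union> B)"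

text \<open>Reachability is reflexive even outside the set walked in, so
  \<open>component B u\<close> contains \<open>u\<close> also for \<open>u\<close> in
  \<open>B\<close>; it is a component of \<open>G - B\<close> only if
  \<open>u \<in> pverts G - B\<close>.\<close>

definition component :: "'a set \<Rightarrow> 'a \<Rightarrow> 'a set" where
  "component B u = {v. reach_in (pverts G - B) u v}"

lemma adj_sym: "adj u v \<longleftrightarrow> adj v u"
  using pair_sym_arcs unfolding symmetric_def sym_def by auto

lemma adj_irrefl: "\<not> adj u u"
  using pair_no_loops by fastforce

lemma vwalk_arcs_successively:
  "set (vwalk_arcs p) \<subseteq> parcs G \<longleftrightarrow> successively adj p"
  by (induct p rule: vwalk_arcs.induct) auto

lemma vpath_iff:
  "vpath p (with_proj G) \<longleftrightarrow> p \<noteq> [] \<and> distinct p \<and> set p \<subseteq> pverts G \<and> successively adj p"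
  by (auto simp: vpath_def vwalk_def vwalk_arcs_successively)

lemma successively_adj_rev: "successively adj (rev p) \<longleftrightarrow> successively adj p"
proof -
  have "(\<lambda>x y. adj y x) = adj"
    by (intro ext) (rule adj_sym)
  then show ?thesis
    unfolding successively_rev by (rule arg_cong[where f = "\<lambda>R. successively R p"])
qed

lemma vpath_rev: "vpath (rev p) (with_proj G) \<longleftrightarrow> vpath p (with_proj G)"
  unfolding vpath_iff successively_adj_rev by simp

lemma detour_rev: "detour G p \<Longrightarrow> detour G (rev p)"
  by (simp add: detour_def vpath_rev)

lemma detour_vpath: "detour G p \<Longrightarrow> vpath p (with_proj G)"
  by (simp add: detour_def)

lemma detour_length: "detour G p \<Longrightarrow> vpath q (with_proj G) \<Longrightarrow> length q \<le> length p"
  by (simp add: detour_def)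

lemma clique_adj: "clique G B \<Longrightarrow> x \<in> B \<Longrightarrow> y \<in> B \<Longrightarrow> x \<noteq> y \<Longrightarrow> adj x y"
  by (simp add: clique_def)

lemma clique_subset: "clique G B \<Longrightarrow> A \<subseteq> B \<Longrightarrow> clique G A"
  unfolding clique_def by blast

lemma vpath_append:
  assumes "vpath p (with_proj G)" "vpath q (with_proj G)"
    and "set p \<inter> set q = {}" "adj (last p) (hd q)"
  shows "vpath (p @ q) (with_proj G)"
  using assms by (auto simp: vpath_iff successively_append_iff)

lemma vpath_append_clique:
  assumes "vpath p (with_proj G)" "vpath q (with_proj G)"
    and "set p \<inter> set q = {}" "clique G B" "last p \<in> B" "hd q \<in> B"
  shows "vpath (p @ q) (with_proj G)"
proof (rule vpath_append[OF assms(1-3)])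
  have "last p \<noteq> hd q"
    using assms by (metis disjoint_iff hd_in_set last_in_set vpath_iff)
  then show "adj (last p) (hd q)"
    using assms clique_adj by blast
qed

text \<open>The first vertex of \<open>p\<close> in \<open>W\<close> is either \<open>hd p\<close>
  itself or is entered from outside \<open>W\<close>; a vertex of \<open>W\<close> with a neighbour
  outside lies in \<open>B\<close>.\<close>

lemma hd_filter_boundary:
  assumes "successively adj p" "filter (\<lambda>v. v \<in> W) p \<noteq> []" "hd p \<notin> W \<or> hd p \<in> B"
    and "\<And>x y. x \<in> W \<Longrightarrow> y \<notin> W \<Longrightarrow> adj x y \<Longrightarrow> x \<in> B"
  shows "hd (filter (\<lambda>v. v \<in> W) p) \<in> B"
  using assms(1-3)
proof (induct p)
  case (Cons x p)
  show ?case
  proof (cases "x \<in> W")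
    case False
    then have ne: "filter (\<lambda>v. v \<in> W) p \<noteq> []" "p \<noteq> []"
      using Cons.prems by auto
    then have "adj x (hd p)"
      using Cons.prems by (auto simp: successively_Cons)
    then have "hd p \<notin> W \<or> hd p \<in> B"
      using assms(4)[of "hd p" x] False adj_sym by blast
    then show ?thesis
      using Cons ne False by (auto simp: successively_Cons)
  qed (use Cons.prems in auto)
qed simp

lemma last_filter_boundary:
  assumes "successively adj p" "filter (\<lambda>v. v \<in> W) p \<noteq> []" "last p \<notin> W \<or> last p \<in> B"
    and "\<And>x y. x \<in> W \<Longrightarrow> y \<notin> W \<Longrightarrow> adj x y \<Longrightarrow> x \<in> B"
  shows "last (filter (\<lambda>v. v \<in> W) p) \<in> B"
proof -
  have "hd (filter (\<lambda>v. v \<in> W) (rev p)) \<in> B"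
    by (rule hd_filter_boundary[OF _ _ _ assms(4)])
      (use assms(1-3) in \<open>auto simp: successively_adj_rev hd_rev filter_empty_conv simp del: successively_rev\<close>)
  then show ?thesis
    by (simp add: hd_rev flip: rev_filter)
qed

text \<open>Where \<open>p\<close> leaves \<open>W\<close> and returns, the last vertex before the
  gap and the first one after it both have neighbours outside \<open>W\<close>. So both are in the
  clique \<open>B\<close>, and an edge of \<open>B\<close> closes the gap.\<close>

lemma successively_filter_clique:
  assumes "clique G B" "\<And>x y. x \<in> W \<Longrightarrow> y \<notin> W \<Longrightarrow> adj x y \<Longrightarrow> x \<in> B"
    and "successively adj p" "distinct p"
  shows "successively adj (filter (\<lambda>v. v \<in> W) p)"
  using assms(3-4)
proof (induct p)
  case (Cons x p)
  then have IH: "successively adj (filter (\<lambda>v. v \<in> W) p)"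
    by (auto simp: successively_Cons)
  show ?case
  proof (cases "x \<in> W \<and> filter (\<lambda>v. v \<in> W) p \<noteq> []")
    case True
    then have ne: "p \<noteq> []" and x: "adj x (hd p)" and p: "successively adj p"
      using Cons.prems by (auto simp: successively_Cons)
    have "adj x (hd (filter (\<lambda>v. v \<in> W) p))"
    proof (cases "hd p \<in> W")
      case True
      then show ?thesis
        using x ne by (cases p) auto
    next
      case False
      then have "x \<in> B" and B: "hd (filter (\<lambda>v. v \<in> W) p) \<in> B"
        using assms(2) x True hd_filter_boundary[OF p, of W B] by auto
      moreover have "hd (filter (\<lambda>v. v \<in> W) p) \<in> set p"
        using True by (metis filter_is_subset hd_in_set subsetD)
      ultimately show ?thesis
        using assms(1) Cons.prems clique_adj by (metis distinct.simps(2))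
    qed
    then show ?thesis
      using True IH by (simp add: successively_Cons)
  qed (use IH in auto)
qed simp

lemma vpath_filter_clique:
  assumes "clique G B" "\<And>x y. x \<in> W \<Longrightarrow> y \<notin> W \<Longrightarrow> adj x y \<Longrightarrow> x \<in> B"
    and "successively adj p" "distinct p" "set p \<subseteq> pverts G" "filter (\<lambda>v. v \<in> W) p \<noteq> []"
  shows "vpath (filter (\<lambda>v. v \<in> W) p) (with_proj G)"
  unfolding vpath_iff
  using assms(4-6) successively_filter_clique[OF assms(1-4)] by (intro conjI) auto

text \<open>These are the two sets to which paths get restricted: \<open>- X\<close> for what is
  kept of one detour, \<open>X \<union> B\<close> for what is taken from the other.\<close>

lemma cut_off_boundary:
  assumes "cut_off B X"
  shows "x \<in> - X \<Longrightarrow> y \<notin> - X \<Longrightarrow> adj x y \<Longrightarrow> x \<in> B"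
    and "x \<in> X \<union> B \<Longrightarrow> y \<notin> X \<union> B \<Longrightarrow> adj x y \<Longrightarrow> x \<in> B"
  using assms adj_sym[of x y] unfolding cut_off_def by blast+

lemma length_filter_less_if_boundary:
  assumes "cut_off B X" "\<exists>b\<in>set q. b \<in> B"
  shows "length (filter (\<lambda>v. v \<in> X) q) < length (filter (\<lambda>v. v \<in> X \<union> B) q)"
proof -
  have "length (filter (\<lambda>v. v \<in> X) q) + length (filter (\<lambda>v. v \<in> B) q)
      = length (filter (\<lambda>v. v \<in> X \<union> B) q)"
    using assms(1) unfolding cut_off_def by (induct q) auto
  moreover have "length (filter (\<lambda>v. v \<in> B) q) > 0"
    using assms(2) by (auto simp: filter_empty_conv)
  ultimately show ?thesis
    by linarith
qed

text \<open>
  The part of \<open>p\<close> inside \<open>X\<close> is replaced by the part of \<open>q\<close> inside \<open>X\<close>; since \<open>q\<close> contributes all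
  its vertices in \<open>B\<close> as well, the exchange gains length unless \<open>p\<close> has more vertices in \<open>X\<close> than \<open>q\<close>.
\<close>
lemma exchange_one_end:
  assumes "clique G B" "cut_off B X" "detour G p" "vpath q (with_proj G)"
    and "set p \<inter> set q \<inter> B = {}"
    and "hd p \<in> X" "last p \<notin> X" "hd q \<in> X" "last q \<notin> X"
  shows "length (filter (\<lambda>v. v \<in> X) q) < length (filter (\<lambda>v. v \<in> X) p)"
proof -
  \<comment> \<open>\<open>?q\<close> runs from \<open>hd q\<close> to a vertex of \<open>B\<close>,
    and \<open>?p\<close> from a vertex of \<open>B\<close> to \<open>last p\<close>. A common
    vertex would be in \<open>B\<close> and on both paths, so the pieces are disjoint and an edge of
    \<open>B\<close> joins them.\<close>
  let ?q = "filter (\<lambda>v. v \<in> X \<union> B) q" and ?p = "filter (\<lambda>v. v \<in> - X) p"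
  note p = detour_vpath[OF assms(3), unfolded vpath_iff] and q = assms(4)[unfolded vpath_iff]
  have ne: "?q \<noteq> []" "?p \<noteq> []"
    using p q assms(7,8) by (auto simp: filter_empty_conv)
  have lq: "last ?q \<in> B"
    by (rule last_filter_boundary[OF _ ne(1) _ cut_off_boundary(2)[OF assms(2)]])
      (use q assms(9) in auto)
  have hp: "hd ?p \<in> B"
    by (rule hd_filter_boundary[OF _ ne(2) _ cut_off_boundary(1)[OF assms(2)]])
      (use p assms(6) in auto)
  have "vpath ?q (with_proj G)"
    by (rule vpath_filter_clique[OF assms(1) cut_off_boundary(2)[OF assms(2)] _ _ _ ne(1)])
      (use q in auto)
  moreover have "vpath ?p (with_proj G)"
    by (rule vpath_filter_clique[OF assms(1) cut_off_boundary(1)[OF assms(2)] _ _ _ ne(2)])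
      (use p in auto)
  moreover have "set ?q \<inter> set ?p = {}"
    using assms(5) by auto
  ultimately have "vpath (?q @ ?p) (with_proj G)"
    using vpath_append_clique assms(1) lq hp by blast
  then have "length ?q + length ?p \<le> length p"
    using detour_length[OF assms(3)] by force
  moreover have "length (filter (\<lambda>v. v \<in> X) p) + length ?p = length p"
    using sum_length_filter_compl[of "\<lambda>v. v \<in> X" p] by simp
  moreover have "\<exists>b\<in>set q. b \<in> B"
    using lq ne(1) last_in_set[OF ne(1)] by auto
  ultimately show ?thesis
    using length_filter_less_if_boundary[OF assms(2), of q] by linarith
qed

text \<open>Cut \<open>p\<close> at a vertex of \<open>X\<close>. What is left outside
  \<open>X\<close> of the front piece ends in \<open>B\<close>, that of the back piece begins in
  \<open>B\<close>, and the part of \<open>q\<close> in \<open>X \<union> B\<close> has both ends in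
  \<open>B\<close>, so it fits between them.\<close>

lemma exchange_no_end:
  assumes "clique G B" "cut_off B X" "detour G p" "vpath q (with_proj G)"
    and "set p \<inter> set q \<inter> B = {}"
    and "hd p \<notin> X" "last p \<notin> X" "hd q \<notin> X" "last q \<notin> X"
    and "set p \<inter> X \<noteq> {}" "set q \<inter> X \<noteq> {}"
  shows "length (filter (\<lambda>v. v \<in> X) q) < length (filter (\<lambda>v. v \<in> X) p)"
proof -
  note p = detour_vpath[OF assms(3), unfolded vpath_iff] and q = assms(4)[unfolded vpath_iff]
  obtain x a c where x: "x \<in> X" and pac: "p = a @ x # c"
    using assms(10) by (metis disjoint_iff split_list)
  have sc: "successively adj (a @ [x])" "successively adj (x # c)" "distinct (a @ [x])" "distinct (x # c)"
    using p unfolding pac by (auto simp: successively_append_iff)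
  have ac: "a \<noteq> []" "c \<noteq> []"
    using assms(6,7) x unfolding pac by auto
  let ?q = "filter (\<lambda>v. v \<in> X \<union> B) q" and ?a = "filter (\<lambda>v. v \<in> - X) a"
    and ?c = "filter (\<lambda>v. v \<in> - X) c"
  \<comment> \<open>Filtering removes \<open>x\<close>, but with \<open>x\<close> attached each
    piece ends or begins in \<open>X\<close>, as the boundary lemmas for \<open>- X\<close>
    require.\<close>
  have a_eq: "?a = filter (\<lambda>v. v \<in> - X) (a @ [x])" and c_eq: "?c = filter (\<lambda>v. v \<in> - X) (x # c)"
    using x by auto
  have ha: "hd a \<in> set a" "hd a \<notin> X" and lc: "last c \<in> set c" "last c \<notin> X"
    using ac assms(6,7) unfolding pac by auto
  then have ne: "?q \<noteq> []" "?a \<noteq> []" "?c \<noteq> []"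
    using assms(11) by (auto simp: filter_empty_conv)
  have hq: "hd ?q \<in> B"
    by (rule hd_filter_boundary[OF _ ne(1) _ cut_off_boundary(2)[OF assms(2)]])
      (use q assms(8) in auto)
  have lq: "last ?q \<in> B"
    by (rule last_filter_boundary[OF _ ne(1) _ cut_off_boundary(2)[OF assms(2)]])
      (use q assms(9) in auto)
  have la: "last ?a \<in> B"
    unfolding a_eq
    by (rule last_filter_boundary[OF sc(1) ne(2)[unfolded a_eq] _ cut_off_boundary(1)[OF assms(2)]])
      (use x in auto)
  have hc: "hd ?c \<in> B"
    unfolding c_eq
    by (rule hd_filter_boundary[OF sc(2) ne(3)[unfolded c_eq] _ cut_off_boundary(1)[OF assms(2)]])
      (use x in auto)
  have vq: "vpath ?q (with_proj G)"
    by (rule vpath_filter_clique[OF assms(1) cut_off_boundary(2)[OF assms(2)] _ _ _ ne(1)])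
      (use q in auto)
  have va: "vpath ?a (with_proj G)" unfolding a_eq
    by (rule vpath_filter_clique[OF assms(1) cut_off_boundary(1)[OF assms(2)] sc(1,3) _ ne(2)[unfolded a_eq]])
      (use p pac in auto)
  have vc: "vpath ?c (with_proj G)" unfolding c_eq
    by (rule vpath_filter_clique[OF assms(1) cut_off_boundary(1)[OF assms(2)] sc(2,4) _ ne(3)[unfolded c_eq]])
      (use p pac in auto)
  have vqc: "vpath (?q @ ?c) (with_proj G)"
    by (rule vpath_append_clique[OF vq vc _ assms(1) lq hc]) (use assms(5) pac in auto)
  have "vpath (?a @ ?q @ ?c) (with_proj G)"
    by (rule vpath_append_clique[OF va vqc _ assms(1) la])
      (use assms(5) pac p hq ne(1) in \<open>auto simp: hd_append\<close>)
  then have "length ?a + length ?q + length ?c \<le> length p"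
    using detour_length[OF assms(3)] by force
  moreover have "length (filter (\<lambda>v. v \<in> X) p) + length ?a + length ?c = length p"
    using sum_length_filter_compl[of "\<lambda>v. v \<in> X" p] x unfolding pac by simp
  moreover have "\<exists>b\<in>set q. b \<in> B"
    using lq ne(1) last_in_set[OF ne(1)] by auto
  ultimately show ?thesis
    using length_filter_less_if_boundary[OF assms(2), of q] by linarith
qed

text \<open>The exchange works in both directions and gives contradictory strict inequalities.
  Reversing the paths reduces to the case that both start in \<open>X\<close>.\<close>

lemma no_common_single_end:
  assumes "clique G B" "cut_off B X" "detour G p" "detour G q" "set p \<inter> set q \<inter> B = {}"
    and "hd p \<in> X \<longleftrightarrow> last p \<notin> X" "hd q \<in> X \<longleftrightarrow> last q \<notin> X"
  shows False
proof -
  have *: False if "detour G p" "detour G q" "set p \<inter> set q \<inter> B = {}"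
    "hd p \<in> X" "last p \<notin> X" "hd q \<in> X" "last q \<notin> X" for p q
    using exchange_one_end[OF assms(1,2) that(1) detour_vpath[OF that(2)] that(3-7)]
      exchange_one_end[OF assms(1,2) that(2) detour_vpath[OF that(1)] _ that(6,7,4,5)] that(3)
    by (simp add: Int_commute)
  have ne: "p \<noteq> []" "q \<noteq> []"
    using assms(3,4) by (auto dest!: detour_vpath simp: vpath_iff)
  show False
    using assms *[of p q] *[of "rev p" q] *[of p "rev q"] *[of "rev p" "rev q"] detour_rev[of p] detour_rev[of q] ne
    by (auto simp: hd_rev last_rev)
qed

lemma no_common_inner:
  assumes "clique G B" "cut_off B X" "detour G p" "detour G q" "set p \<inter> set q \<inter> B = {}"
    and "hd p \<notin> X" "last p \<notin> X" "hd q \<notin> X" "last q \<notin> X"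
  shows "set p \<inter> X = {} \<or> set q \<inter> X = {}"
proof (rule ccontr)
  assume "\<not> ?thesis"
  then show False
    using exchange_no_end[OF assms(1,2,3) detour_vpath[OF assms(4)] assms(5-9)]
      exchange_no_end[OF assms(1,2,4) detour_vpath[OF assms(3)] _ assms(8,9,6,7)] assms(5)
    by (simp add: Int_ac)
qed

section \<open>Shortest walks and components\<close>

lemma reach_in_refl: "reach_in A x x"
  by (simp add: reach_in_def)

lemma reach_in_trans: "reach_in A x y \<Longrightarrow> reach_in A y z \<Longrightarrow> reach_in A x z"
  by (simp add: reach_in_def)

lemma reach_in_step: "adj x y \<Longrightarrow> x \<in> A \<Longrightarrow> y \<in> A \<Longrightarrow> reach_in A x y"
  unfolding reach_in_def by (rule r_into_rtranclp) simp

lemma reach_in_sym: "reach_in A x y \<Longrightarrow> reach_in A y x"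
  unfolding reach_in_def
proof (induct rule: rtranclp_induct)
  case (step y z)
  then show ?case
    using adj_sym by (metis (mono_tags, lifting) converse_rtranclp_into_rtranclp)
qed simp

lemma reach_in_cut_off:
  assumes "reach_in A x y" "A \<inter> B = {}" "cut_off B X" "x \<in> X"
  shows "y \<in> X"
  using assms(1,4) unfolding reach_in_def
proof (induct rule: rtranclp_induct)
  case (step y z)
  then show ?case
    using assms(2,3) unfolding cut_off_def by blast
qed simp

lemma reach_in_walk:
  assumes "reach_in A x y" "x \<in> A"
  shows "\<exists>w. w \<noteq> [] \<and> successively adj w \<and> set w \<subseteq> A \<and> hd w = x \<and> last w = y"
  using assms(1) unfolding reach_in_def
proof (induct rule: rtranclp_induct)
  case base
  show ?case
    by (rule exI[of _ "[x]"]) (use assms(2) in simp)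
next
  case (step y z)
  then obtain w where "w \<noteq> [] \<and> successively adj w \<and> set w \<subseteq> A \<and> hd w = x \<and> last w = y"
    by blast
  then show ?case
    using step(2) by (intro exI[of _ "w @ [z]"]) (auto simp: successively_append_iff)
qed

text \<open>Take \<open>w\<close> of least length. Dropping a front part, a back part, or the
  stretch between two adjacent vertices would shorten it, so only its first vertex satisfies
  \<open>S\<close>, only its last satisfies \<open>T\<close>, and it is induced.\<close>

lemma shortest_walk:
  assumes "connected_in A" "x \<in> A" "S x" "y \<in> A" "T y"
  obtains w where "w \<noteq> []" "successively adj w" "set w \<subseteq> A" "S (hd w)" "T (last w)" "distinct w"
    and "\<And>a x b. w = a @ x # b \<Longrightarrow> S x \<Longrightarrow> a = []"
    and "\<And>a x b. w = a @ x # b \<Longrightarrow> T x \<Longrightarrow> b = []"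
    and "\<And>a x b y c. w = a @ x # b @ y # c \<Longrightarrow> adj x y \<Longrightarrow> b = []"
proof -
  define W where "W w \<longleftrightarrow> w \<noteq> [] \<and> successively adj w \<and> set w \<subseteq> A \<and> S (hd w) \<and> T (last w)" for w
  have "\<exists>w. W w"
    using reach_in_walk[of A x y] assms unfolding connected_in_def W_def by blast
  then obtain w where w: "W w" and "\<forall>v. W v \<longrightarrow> length w \<le> length v"
    using ex_has_least_nat[of W _ length] by blast
  then have least: "W v \<Longrightarrow> length w \<le> length v" for v
    by blast
  show thesis
  proof (rule that)
    show "w \<noteq> []" "successively adj w" "set w \<subseteq> A" "S (hd w)" "T (last w)"
      using w by (auto simp: W_def)
    show "a = []" if "w = a @ x # b" "S x" for a x b
      using w least[of "x # b"] that by (auto simp: W_def successively_append_iff)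
    show "b = []" if "w = a @ x # b" "T x" for a x b
    proof -
      have "W (a @ [x])"
        using w that(2) unfolding that(1) W_def
        by (auto simp: successively_append_iff hd_append_Cons)
      then show ?thesis
        using least[of "a @ [x]"] that(1) by simp
    qed
    show "b = []" if "w = a @ x # b @ y # c" "adj x y" for a x b y c
    proof -
      have "W (a @ x # y # c)"
        using w that(2) unfolding that(1) W_def
        by (auto simp: successively_append_iff successively_Cons hd_append_Cons)
      then show ?thesis
        using least[of "a @ x # y # c"] that(1) by simp
    qed
    show "distinct w"
    proof (rule ccontr)
      assume "\<not> distinct w"
      then obtain a b c z where d: "w = a @ [z] @ b @ [z] @ c"
        using not_distinct_decomp by blast
      then have "W (a @ z # c)"
        using w unfolding d W_def
        by (auto simp: successively_append_iff successively_Cons hd_append_Cons)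
      then show False
        using least d by force
    qed
  qed
qed

text \<open>The two pieces into which \<open>x\<close> splits \<open>p\<close> both count
  \<open>x\<close>, so the longer one has more than half of the vertices; it is reversed if
  necessary to end in \<open>x\<close>.\<close>

lemma long_half:
  assumes "vpath p (with_proj G)" "x \<in> set p"
  obtains h where "vpath (h @ [x]) (with_proj G)" "set (h @ [x]) \<subseteq> set p" "length p < 2 * length (h @ [x])"
proof -
  obtain a b where p: "p = a @ x # b"
    using assms(2) by (metis split_list)
  have "vpath (a @ [x]) (with_proj G)" "vpath (x # b) (with_proj G)"
    using assms(1) unfolding p by (auto simp: vpath_iff successively_append_iff)
  then show thesis
    using that[of a] that[of "rev b"] vpath_rev[of "x # b"] unfolding p
    by (cases "length a \<ge> length b") auto
qed

text \<open>Two disjoint detours are joined by a shortest walk with no inner vertex on either. The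
  longer half of each, together with this walk, forms a path longer than a detour.\<close>

lemma detours_intersect:
  assumes "connected_in (pverts G)" "detour G p" "detour G q"
  shows "set p \<inter> set q \<noteq> {}"
proof
  assume disj: "set p \<inter> set q = {}"
  have p: "p \<noteq> []" "set p \<subseteq> pverts G" and q: "q \<noteq> []" "set q \<subseteq> pverts G"
    using assms(2,3) by (auto dest!: detour_vpath simp: vpath_iff)
  obtain w where w: "w \<noteq> []" "successively adj w" "set w \<subseteq> pverts G"
    "hd w \<in> set p" "last w \<in> set q" "distinct w"
    and wp: "\<And>a x b. w = a @ x # b \<Longrightarrow> x \<in> set p \<Longrightarrow> a = []"
    and wq: "\<And>a x b. w = a @ x # b \<Longrightarrow> x \<in> set q \<Longrightarrow> b = []"
    and "\<And>a x b y c. w = a @ x # b @ y # c \<Longrightarrow> adj x y \<Longrightarrow> b = []"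
    by (rule shortest_walk[where S = "\<lambda>x. x \<in> set p" and T = "\<lambda>x. x \<in> set q",
          OF assms(1) subsetD[OF p(2) hd_in_set[OF p(1)]] hd_in_set[OF p(1)]
          subsetD[OF q(2) hd_in_set[OF q(1)]] hd_in_set[OF q(1)]]) (rule that)
  obtain x w' where w1: "w = x # w'"
    using w(1) by (cases w) auto
  have "w' \<noteq> []"
    using w disj unfolding w1 by auto
  then obtain r y where w2: "w = x # r @ [y]"
    using w1 by (metis rev_exhaust)
  have x: "x \<in> set p" and y: "y \<in> set q"
    using w unfolding w2 by auto
  have rp: "set r \<inter> set p = {}"
  proof (rule ccontr)
    assume "set r \<inter> set p \<noteq> {}"
    then obtain z a b where "z \<in> set p" "r = a @ z # b"
      by (metis disjoint_iff split_list)
    then show False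
      using wp[of "x # a" z "b @ [y]"] w2 by simp
  qed
  have rq: "set r \<inter> set q = {}"
  proof (rule ccontr)
    assume "set r \<inter> set q \<noteq> {}"
    then obtain z a b where "z \<in> set q" "r = a @ z # b"
      by (metis disjoint_iff split_list)
    then show False
      using wq[of "x # a" z "b @ [y]"] w2 by simp
  qed
  obtain h where h: "vpath (h @ [x]) (with_proj G)" "set (h @ [x]) \<subseteq> set p" "length p < 2 * length (h @ [x])"
    using long_half[OF detour_vpath[OF assms(2)] x] by blast
  obtain k where k: "vpath (k @ [y]) (with_proj G)" "set (k @ [y]) \<subseteq> set q" "length q < 2 * length (k @ [y])"
    using long_half[OF detour_vpath[OF assms(3)] y] by blast
  have k': "vpath (y # rev k) (with_proj G)"
    using k(1) vpath_rev[of "k @ [y]"] by simp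
  have "vpath (h @ x # r @ y # rev k) (with_proj G)"
    using h(1,2) k' k(2) w(2,3,6) rp rq disj unfolding w2 vpath_iff
    by (auto simp: successively_append_iff successively_Cons hd_append_Cons simp del: successively_rev)
  then have "length (h @ x # r @ y # rev k) \<le> length p"
    using detour_length assms(2) by blast
  moreover have "length p = length q"
    using detour_length[OF assms(2) detour_vpath[OF assms(3)]]
      detour_length[OF assms(3) detour_vpath[OF assms(2)]] by simp
  ultimately show False
    using h(3) k(3) by simp
qed

section \<open>Components after deleting a set of vertices\<close>

lemma component_self: "u \<in> component B u"
  by (simp add: component_def reach_in_refl)

lemma component_subset:
  assumes "u \<in> pverts G - B"
  shows "component B u \<subseteq> pverts G - B"
proof
  fix v assume "v \<in> component B u"
  then show "v \<in> pverts G - B"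
    unfolding component_def mem_Collect_eq reach_in_def using assms
    by (induct rule: rtranclp_induct) auto
qed

lemma component_eq: "v \<in> component B u \<Longrightarrow> component B v = component B u"
  unfolding component_def using reach_in_sym reach_in_trans by blast

lemma cut_off_component:
  assumes "u \<in> pverts G - B"
  shows "cut_off B (component B u)"
  unfolding cut_off_def
proof (intro conjI ballI allI impI)
  fix x y assume x: "x \<in> component B u" and xy: "adj x y"
  show "y \<in> component B u \<union> B"
  proof (cases "y \<in> B")
    case False
    then have "reach_in (pverts G - B) x y"
      using reach_in_step[OF xy] in_arcsD2[OF xy] component_subset[OF assms] x by blast
    then show ?thesis
      using x reach_in_trans unfolding component_def by blast
  qed simp
qed (use component_subset[OF assms] in auto)

lemma connected_in_component:
  assumes "u \<in> pverts G - B"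
  shows "connected_in (component B u)"
proof -
  have "reach_in (component B u) u v" if "reach_in (pverts G - B) u v" for v
    using that unfolding reach_in_def[of "pverts G - B"]
  proof (induct rule: rtranclp_induct)
    case (step y z)
    then have "y \<in> component B u"
      unfolding component_def reach_in_def by simp
    moreover have "z \<in> component B u"
      using step(1,2) unfolding component_def reach_in_def mem_Collect_eq
      by (rule rtranclp.rtrancl_into_rtrancl)
    ultimately have "reach_in (component B u) y z"
      using step(2) reach_in_step by blast
    with step(3) show ?case
      by (rule reach_in_trans)
  qed (rule reach_in_refl)
  then have "reach_in (component B u) u v" if "v \<in> component B u" for v
    using that by (simp add: component_def)
  then show ?thesis
    unfolding connected_in_def using reach_in_sym reach_in_trans by blast
qed

lemma walk_subset_component:
  assumes "successively adj p" "p \<noteq> []" "set p \<subseteq> pverts G" "set p \<inter> B = {}"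
  shows "set p \<subseteq> component B (hd p)"
  using assms
proof (induct p)
  case (Cons x p)
  show ?case
  proof (cases "p = []")
    case False
    then have "set p \<subseteq> component B (hd p)" "adj x (hd p)" "hd p \<in> set p"
      using Cons by (auto simp: successively_Cons)
    moreover from this have "reach_in (pverts G - B) x (hd p)"
      using Cons.prems by (intro reach_in_step) auto
    then have "hd p \<in> component B x"
      by (simp add: component_def)
    ultimately show ?thesis
      using component_eq[of "hd p" B x] component_self[of x B] by auto
  qed (simp add: component_self)
qed simp

section \<open>Cliques in chordal graphs\<close>

text \<open>Chordality for cycles given as vertex lists. The closing arc is not among the
  \<open>vwalk_arcs c\<close>, so it is excluded separately, in both orientations.\<close>

lemma chordal_vertex_cycle:
  assumes "chordal G" "distinct c" "4 \<le> length c" "set c \<subseteq> pverts G"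
    and "successively adj c" "adj (last c) (hd c)"
  obtains u v where "u \<in> set c" "v \<in> set c" "adj u v"
    and "(u, v) \<notin> set (vwalk_arcs c)" "(v, u) \<notin> set (vwalk_arcs c)"
    and "(u, v) \<noteq> (last c, hd c)" "(v, u) \<noteq> (last c, hd c)"
proof -
  let ?c = "vwalk_arcs c @ [(last c, hd c)]"
  have ne: "c \<noteq> []"
    using assms(3) by auto
  have "set ?c \<subseteq> parcs G"
    using assms(5,6) vwalk_arcs_successively by auto
  then have "awalk (hd c) ?c (hd c)"
    unfolding awalk_def using assms(4) ne pcas_vwalk_arcs[OF ne] by auto
  moreover have "distinct (tl (c @ [hd c]))"
    using ne assms(2) by (cases c) auto
  ultimately have "pre_digraph.cycle (with_proj G) ?c"
    unfolding cycle_def using pawalk_verts_vwalk_arcs[OF ne] by auto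
  moreover have "4 \<le> length ?c"
    using assms(3) length_vwalk_arcs[OF ne] by simp
  ultimately obtain e where "chord G ?c e"
    using assms(1) unfolding chordal_def by blast
  then show thesis
    unfolding chord_def fst_vwalk_arcs[OF ne] using that[of "fst e" "snd e"] by auto
qed

lemma induced_path_adj:
  assumes "\<And>a x b y c. q = a @ x # b @ y # c \<Longrightarrow> adj x y \<Longrightarrow> b = []"
    and "u \<in> set q" "v \<in> set q" "adj u v"
  shows "(u, v) \<in> set (vwalk_arcs q) \<or> (v, u) \<in> set (vwalk_arcs q)"
proof -
  obtain a b where q: "q = a @ u # b"
    using assms(2) by (metis split_list)
  have "v \<noteq> u"
    using assms(4) adj_irrefl by blast
  then consider "v \<in> set a" | "v \<in> set b"
    using assms(3) q by auto
  then show ?thesis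
  proof cases
    case 1
    then obtain a1 a2 where "a = a1 @ v # a2"
      by (metis split_list)
    then have "q = a1 @ v # u # b"
      using assms(1)[of a1 v a2 u b] assms(4) adj_sym[of u v] q by auto
    then show ?thesis
      using in_vwalk_arcs by metis
  next
    case 2
    then obtain b1 b2 where "b = b1 @ v # b2"
      by (metis split_list)
    then have "q = a @ u # v # b2"
      using assms(1)[of a u b1 v b2] assms(4) q by auto
    then show ?thesis
      using in_vwalk_arcs by metis
  qed
qed

text \<open>Choose \<open>v\<close> in \<open>C\<close> with the most neighbours in
  \<open>B\<close>. If it misses \<open>s\<close>, follow a shortest walk in \<open>C\<close> from
  \<open>v\<close> to a neighbour of \<open>s\<close>: its end sees \<open>s\<close> and, by
  chordality, everything in \<open>B\<close> that \<open>v\<close> sees, against maximality.\<close>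

lemma exists_vertex_complete_to_clique:
  assumes "chordal G" "clique G B" "C \<noteq> {}" "C \<subseteq> pverts G" "C \<inter> B = {}" "connected_in C"
    and "\<forall>b\<in>B. \<exists>x\<in>C. adj x b"
  shows "\<exists>v\<in>C. \<forall>b\<in>B. adj v b"
proof -
  define N where "N x = {b \<in> B. adj x b}" for x
  have finB: "finite B" and finC: "finite C"
    using assms(2,4) pair_finite_verts finite_subset unfolding clique_def by blast+
  then have "Max ((\<lambda>x. card (N x)) ` C) \<in> (\<lambda>x. card (N x)) ` C"
    using assms(3) by (intro Max_in) auto
  then obtain v where v: "v \<in> C" and Nv: "Max ((\<lambda>x. card (N x)) ` C) = card (N v)"
    by blast
  have max: "card (N u) \<le> card (N v)" if "u \<in> C" for u
    unfolding Nv[symmetric] using that finC by simp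
  have "adj v s" if s: "s \<in> B" for s
  proof (rule ccontr)
    assume nvs: "\<not> adj v s"
    obtain z where z: "z \<in> C" "adj z s"
      using assms(7) s by blast
    obtain w where w: "w \<noteq> []" "successively adj w" "set w \<subseteq> C" "hd w = v" "adj (last w) s" "distinct w"
      and "\<And>a x b. w = a @ x # b \<Longrightarrow> x = v \<Longrightarrow> a = []"
      and ws: "\<And>a x b. w = a @ x # b \<Longrightarrow> adj x s \<Longrightarrow> b = []"
      and wi: "\<And>a x b y c. w = a @ x # b @ y # c \<Longrightarrow> adj x y \<Longrightarrow> b = []"
      by (rule shortest_walk[OF assms(6) v, of "\<lambda>x. x = v" z "\<lambda>x. adj x s", OF refl z]) (rule that)
    have lw: "last w \<in> C"
      using w by auto
    have "adj (last w) t" if t: "t \<in> N v" for t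
    proof (rule ccontr)
      assume nt: "\<not> adj (last w) t"
      have tB: "t \<in> B" and vt: "adj v t"
        using t by (auto simp: N_def)
      have "\<exists>x\<in>set w. adj x t"
        using w(1,4) vt by (metis hd_in_set)
      then obtain a p b where wd: "w = a @ p # b" and pt: "adj p t" and bt: "\<forall>x\<in>set b. \<not> adj x t"
        using split_list_last_prop[of w "\<lambda>x. adj x t"] by blast
      \<comment> \<open>\<open>p\<close> is the last neighbour of \<open>t\<close> on
        \<open>w\<close>, and the end of \<open>w\<close> is not a neighbour of \<open>t\<close>.
        Hence the cycle from \<open>t\<close> through \<open>p # b\<close> to \<open>s\<close> and
        back has at least four vertices.\<close>
      have "b \<noteq> []"
        using wd pt nt by auto
      have ts: "t \<noteq> s"
        using vt nvs by blast
      let ?c = "t # (p # b) @ [s]"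
      have pC: "set (p # b) \<subseteq> C"
        using w(3) wd by auto
      have lp: "last (p # b) = last w"
        using wd by simp
      have d: "distinct ?c"
        using w(6) pC assms(5) tB s ts unfolding wd by auto
      have l: "4 \<le> length ?c"
        using \<open>b \<noteq> []\<close> by (cases b) auto
      have V: "set ?c \<subseteq> pverts G"
        using pC assms(2,4) tB s unfolding clique_def by auto
      have "successively adj (p # b)"
        using w(2) unfolding wd successively_append_iff by simp
      then have "successively adj ((p # b) @ [s])"
        unfolding successively_append_iff lp using w(5) by simp
      then have suc: "successively adj ?c"
        using pt adj_sym[of p t] by simp
      have st: "adj (last ?c) (hd ?c)"
        using clique_adj[OF assms(2) s tB] ts by auto
      obtain u x where ux: "u \<in> set ?c" "x \<in> set ?c" "adj u x"
        "(u, x) \<notin> set (vwalk_arcs ?c)" "(x, u) \<notin> set (vwalk_arcs ?c)"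
        "(u, x) \<noteq> (s, t)" "(x, u) \<noteq> (s, t)"
        using chordal_vertex_cycle[OF assms(1) d l V suc st] by auto
      have "vwalk_arcs ?c = (t, p) # vwalk_arcs (p # b) @ [(last w, s)]"
        using vwalk_arcs_append[of "p # b" "[s]"] lp by simp
      then have arcs: "(t, p) \<in> set (vwalk_arcs ?c)" "(last w, s) \<in> set (vwalk_arcs ?c)"
        "set (vwalk_arcs (p # b)) \<subseteq> set (vwalk_arcs ?c)"
        by auto
      \<comment> \<open>The cycle has no chord: on \<open>p # b\<close>, \<open>t\<close> sees only
        \<open>p\<close>, \<open>s\<close> sees only the last vertex since \<open>w\<close> is
        shortest, and adjacent vertices are consecutive since \<open>w\<close> is induced.\<close>
      have tadj: "y = p" if "y \<in> set (p # b)" "adj y t" for y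
        using that bt by auto
      have sadj: "y = last w" if y: "y \<in> set (p # b)" "adj y s" for y
      proof -
        obtain b1 b2 where pb: "p # b = b1 @ y # b2"
          using split_list[OF y(1)] by blast
        have "w = (a @ b1) @ y # b2"
          unfolding wd pb by simp
        moreover from this have "b2 = []"
          by (rule ws) (rule y(2))
        ultimately show ?thesis
          by simp
      qed
      have inner: "(y, y') \<in> set (vwalk_arcs ?c) \<or> (y', y) \<in> set (vwalk_arcs ?c)"
        if "y \<in> set (p # b)" "y' \<in> set (p # b)" "adj y y'" for y y'
      proof -
        have "b' = []" if "p # b = a' @ x' # b' @ z' # c'" "adj x' z'" for a' x' b' z' c'
        proof (rule wi)
          show "w = (a @ a') @ x' # b' @ z' # c'"
            unfolding wd that(1) by simp
        qed (rule that(2))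
        then have "(y, y') \<in> set (vwalk_arcs (p # b)) \<or> (y', y) \<in> set (vwalk_arcs (p # b))"
          by (rule induced_path_adj[OF _ that])
        then show ?thesis
          using arcs(3) by blast
      qed
      have *: False if "u = t \<or> u = s" "(u, x) \<notin> set (vwalk_arcs ?c)" "(x, u) \<notin> set (vwalk_arcs ?c)"
        "x \<in> set (p # b)" "adj x u" for u x
        using that(1)
      proof
        assume "u = t"
        then show False
          using tadj[OF that(4)] that(2,5) arcs(1) by metis
      next
        assume "u = s"
        then show False
          using sadj[OF that(4)] that(3,5) arcs(2) by metis
      qed
      have "u \<noteq> x" and xu: "adj x u"
        using ux(3) adj_irrefl[of u] adj_sym[of u x] by auto
      have "u \<in> set (p # b) \<or> u = t \<or> u = s" "x \<in> set (p # b) \<or> x = t \<or> x = s"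
        using ux(1,2) by simp_all blast+
      then consider "u \<in> set (p # b)" "x \<in> set (p # b)" | "u = t \<or> u = s" "x \<in> set (p # b)"
        | "x = t \<or> x = s" "u \<in> set (p # b)" | "u = t \<or> u = s" "x = t \<or> x = s"
        by blast
      then show False
      proof cases
        case 1
        then show False
          using inner ux(3-5) by blast
      next
        case 2
        then show False
          using *[of u x] ux(4,5) xu by blast
      next
        case 3
        then show False
          using *[of x u] ux(3,4,5) by blast
      next
        case 4
        then show False
          using ux(6,7) \<open>u \<noteq> x\<close> by auto
      qed
    qed
    then have "insert s (N v) \<subseteq> N (last w)"
      using w(5) s by (auto simp: N_def)
    moreover have "s \<notin> N v" "finite (N (last w))" "finite (N v)"
      using nvs finB by (auto simp: N_def)
    ultimately have "card (N v) < card (N (last w))"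
      by (metis card_insert_disjoint card_mono less_eq_Suc_le)
    then show False
      using max[OF lw] by simp
  qed
  then show ?thesis
    using v by blast
qed

section \<open>The component a clique points to\<close>

text \<open>Otherwise \<open>b\<close> could be put in front of \<open>p\<close>, giving a longer
  path.\<close>

lemma detour_hd_notin_clique:
  assumes "clique G B" "detour G p" "b \<in> B" "b \<notin> set p"
  shows "hd p \<notin> B"
proof
  assume hp: "hd p \<in> B"
  have "vpath ([b] @ p) (with_proj G)"
    by (rule vpath_append_clique[OF _ detour_vpath[OF assms(2)] _ assms(1) _ hp])
      (use assms in \<open>auto simp: vpath_iff clique_def\<close>)
  then show False
    using detour_length[OF assms(2)] by force
qed

lemma detour_last_notin_clique:
  assumes "clique G B" "detour G p" "b \<in> B" "b \<notin> set p"
  shows "last p \<notin> B"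
  using detour_hd_notin_clique[OF assms(1) detour_rev[OF assms(2)] assms(3)] assms(4)
  by (simp add: hd_rev)

text \<open>Otherwise \<open>b\<close> could be inserted between \<open>last p\<close> and
  \<open>hd q\<close>.\<close>

lemma detour_no_clique_edge:
  assumes "clique G B" "detour G (p @ q)" "p \<noteq> []" "q \<noteq> []" "b \<in> B" "b \<notin> set (p @ q)" "last p \<in> B"
  shows "hd q \<notin> B"
proof
  assume hq: "hd q \<in> B"
  have p: "vpath p (with_proj G)" and q: "vpath q (with_proj G)" and pq: "set p \<inter> set q = {}"
    using detour_vpath[OF assms(2)] assms(3,4) by (auto simp: vpath_iff successively_append_iff)
  have "vpath ([b] @ q) (with_proj G)"
    by (rule vpath_append_clique[OF _ q _ assms(1) _ hq])
      (use assms in \<open>auto simp: vpath_iff clique_def\<close>)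
  then have "vpath (p @ [b] @ q) (with_proj G)"
    by (rule vpath_append_clique[OF p _ _ assms(1) assms(7)]) (use assms pq in auto)
  then show False
    using detour_length[OF assms(2)] by force
qed

text \<open>The predecessor of \<open>z\<close> on \<open>p\<close> exists and lies outside
  \<open>B\<close> by the two preceding maximality arguments, so it is in \<open>C\<close>. This
  allows \<open>B\<close> to be cut down to the neighbours of \<open>C\<close>.\<close>

lemma detour_clique_vertex_adj:
  assumes "clique G B" "detour G p" "b \<in> B" "b \<notin> set p" "set p \<subseteq> C \<union> B" "z \<in> set p" "z \<in> B"
  shows "\<exists>x\<in>C. adj x z"
proof -
  obtain a c where p: "p = a @ z # c"
    using split_list[OF assms(6)] by blast
  have a: "a \<noteq> []"
    using detour_hd_notin_clique[OF assms(1-4)] assms(7) p by auto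
  then have "last a \<notin> B"
    using detour_no_clique_edge[OF assms(1), of a "z # c"] assms(2,3,4,7) unfolding p by auto
  moreover have "last a \<in> set p"
    using a p by simp
  moreover have "adj (last a) z"
    using detour_vpath[OF assms(2)] a unfolding p vpath_iff successively_append_iff by simp
  ultimately show ?thesis
    using assms(5) by blast
qed

lemma in_component_iff: "v \<in> component B u \<longleftrightarrow> component B v = component B u"
  using component_eq component_self by metis

lemma cut_off_Un: "cut_off B X \<Longrightarrow> cut_off B Y \<Longrightarrow> cut_off B (X \<union> Y)"
  unfolding cut_off_def by blast

text \<open>If both were split, taking the component of \<open>hd p\<close> and then that of
  \<open>hd q\<close> as \<open>X\<close> shows that neither contains an end of the other path.
  Their union then contains exactly one end of each path, which is impossible.\<close>

lemma detours_not_both_split: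
  assumes "clique G B" "detour G p" "detour G q" "set p \<inter> set q \<inter> B = {}"
    and "hd p \<notin> B" "last p \<notin> B" "hd q \<notin> B" "last q \<notin> B"
  shows "component B (hd p) = component B (last p) \<or> component B (hd q) = component B (last q)"
proof (rule ccontr)
  assume "\<not> ?thesis"
  then have split: "component B (last p) \<noteq> component B (hd p)" "component B (last q) \<noteq> component B (hd q)"
    by auto
  have V: "hd p \<in> pverts G - B" "hd q \<in> pverts G - B"
    using detour_vpath[OF assms(2)] detour_vpath[OF assms(3)] assms(5,7) by (auto simp: vpath_iff)
  note cut = cut_off_component[OF V(1)] cut_off_component[OF V(2)]
  note no = no_common_single_end[OF assms(1) _ assms(2-4)]
  show False
    using no[OF cut(1)] no[OF cut(2)] no[OF cut_off_Un[OF cut]] split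
    unfolding Un_iff in_component_iff by metis
qed

lemma majority_direction:
  fixes P :: "nat \<Rightarrow> 'a list"
  assumes "connected_in (pverts G)" "clique G B"
    and det: "\<And>i. i < 5 \<Longrightarrow> detour G (P i)"
    and meet: "\<And>i. i < 5 \<Longrightarrow> set (P i) \<inter> B \<noteq> {}"
    and disj: "\<And>i j. i < 5 \<Longrightarrow> j < 5 \<Longrightarrow> i \<noteq> j \<Longrightarrow> set (P i) \<inter> set (P j) \<inter> B = {}"
  shows "\<exists>u i j. u \<in> pverts G - B \<and> i < 5 \<and> j < 5 \<and> i \<noteq> j
    \<and> set (P i) \<subseteq> component B u \<union> B \<and> set (P j) \<subseteq> component B u \<union> B"
proof -
  have missing: "\<exists>b\<in>B. b \<notin> set (P i)" if "i < 5" for i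
  proof -
    obtain j :: nat where "j < 5" "j \<noteq> i"
      by (cases "i = 0") (auto intro: that[of 0] that[of 1])
    then show ?thesis
      using meet[of j] disj[of i j] that by blast
  qed
  have ends: "hd (P i) \<notin> B" "last (P i) \<notin> B" if "i < 5" for i
    using missing[OF that] detour_hd_notin_clique[OF assms(2) det[OF that]]
      detour_last_notin_clique[OF assms(2) det[OF that]] by blast+
  have V: "set (P i) \<subseteq> pverts G" "P i \<noteq> []" if "i < 5" for i
    using detour_vpath[OF det[OF that]] by (auto simp: vpath_iff)
  define C where "C i = component B (hd (P i))" for i
  have hdV: "hd (P i) \<in> pverts G - B" if "i < 5" for i
    using ends(1)[OF that] V[OF that] by auto
  have cut: "cut_off B (C i)" if "i < 5" for i
    unfolding C_def using cut_off_component hdV[OF that] by blast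
  define closed where "closed i \<longleftrightarrow> component B (last (P i)) = C i" for i
  have "closed i \<or> closed j" if "i < 5" "j < 5" "i \<noteq> j" for i j
    using detours_not_both_split[OF assms(2) det[OF that(1)] det[OF that(2)] disj[OF that]
        ends[OF that(1)] ends[OF that(2)]] unfolding closed_def C_def by auto
  \<comment> \<open>\<open>e\<close> is the detour with ends in different components, or an
    arbitrary index if there is none, so that exactly four remain.\<close>
  then obtain e :: nat where e: "e < 5" "\<And>i. i < 5 \<Longrightarrow> i \<noteq> e \<Longrightarrow> closed i"
    by (metis zero_less_numeral)
  define D where "D = {..<5} - {e}"
  have D: "i < 5" "closed i" if "i \<in> D" for i
    using that e(2) by (auto simp: D_def)
  have hl: "hd (P i) \<in> C k \<longleftrightarrow> C i = C k" "last (P i) \<in> C k \<longleftrightarrow> C i = C k" if "i \<in> D" for i k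
    using D(2)[OF that] unfolding C_def closed_def in_component_iff by auto
  have inner: "set (P i) \<inter> X = {} \<or> set (P j) \<inter> X = {}"
    if "i \<in> D" "j \<in> D" "i \<noteq> j" "cut_off B X" "C i \<inter> X = {}" "C j \<inter> X = {}" for i j X
    using no_common_inner[OF assms(2) that(4) det[OF D(1)[OF that(1)]] det[OF D(1)[OF that(2)]]
        disj[OF D(1)[OF that(1)] D(1)[OF that(2)] that(3)]] that(5,6)
      hl[OF that(1), of i] hl[OF that(2), of j] by blast
  have C_disj: "C i \<inter> component B z = {}" if "C i \<noteq> component B z" for i z
    using that component_eq unfolding C_def by blast
  have "\<exists>x\<in>D. \<exists>y\<in>D. \<exists>z\<in>D. x \<noteq> y \<and> y \<noteq> z \<and> x \<noteq> z \<and> C x = C y \<and> C y = C z"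
  proof (rule three_in_common_class[where M = "\<lambda>i X. set (P i) \<inter> X \<noteq> {}"])
    show "card D = 4"
      using e(1) by (simp add: D_def)
  next
    fix i j assume ij: "i \<in> D" "j \<in> D" "i \<noteq> j" "C i \<noteq> C j"
    \<comment> \<open>The two detours intersect, but not in \<open>B\<close>. Both enter the
      component of the common vertex \<open>z\<close>, so it must hold the ends of one of
      them.\<close>
    obtain z where z: "z \<in> set (P i)" "z \<in> set (P j)"
      using detours_intersect[OF assms(1) det[OF D(1)[OF ij(1)]] det[OF D(1)[OF ij(2)]]] by blast
    then have zV: "z \<in> pverts G - B"
      using disj[OF D(1)[OF ij(1)] D(1)[OF ij(2)] ij(3)] V[OF D(1)[OF ij(1)]] by blast
    have "C i = component B z \<or> C j = component B z"
      using inner[OF ij(1-3) cut_off_component[OF zV]] C_disj[of i z] C_disj[of j z] z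
        component_self[of z B] by blast
    then show "set (P i) \<inter> C j \<noteq> {} \<or> set (P j) \<inter> C i \<noteq> {}"
      using z component_self[of z B] by blast
  next
    fix i j k assume "i \<in> D" "j \<in> D" "k \<in> D" "i \<noteq> j" "C i \<noteq> C k" "C j \<noteq> C k"
      "set (P i) \<inter> C k \<noteq> {}" "set (P j) \<inter> C k \<noteq> {}"
    then show False
      using inner[of i j "C k"] cut[OF D(1)[of k]] C_disj unfolding C_def by blast
  qed
  then obtain x y z where xyz: "x \<in> D" "y \<in> D" "z \<in> D" "x \<noteq> y" "y \<noteq> z" "x \<noteq> z"
    "C y = C x" "C z = C x"
    by metis
  \<comment> \<open>The rest of the graph is again a union of components. Of any two detours with
    ends in \<open>C x\<close> at most one enters it, so two of the three avoid it.\<close>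
  have "cut_off B (pverts G - C x - B)"
    using cut[OF D(1)[OF xyz(1)]] adj_sym in_arcsD2 unfolding cut_off_def by blast
  then have "set (P i) \<inter> (pverts G - C x - B) = {} \<or> set (P j) \<inter> (pverts G - C x - B) = {}"
    if "i \<in> D" "j \<in> D" "i \<noteq> j" "C i = C x" "C j = C x" for i j
    using inner[OF that(1-3)] that(4,5) by blast
  then have "set (P i) \<subseteq> C x \<union> B \<or> set (P j) \<subseteq> C x \<union> B"
    if "i \<in> D" "j \<in> D" "i \<noteq> j" "C i = C x" "C j = C x" for i j
    using that V(1)[OF D(1)[OF that(1)]] V(1)[OF D(1)[OF that(2)]] by blast
  then have "\<exists>i\<in>D. \<exists>j\<in>D. i \<noteq> j \<and> set (P i) \<subseteq> C x \<union> B \<and> set (P j) \<subseteq> C x \<union> B"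
    using xyz by metis
  then show ?thesis
    using D(1) hdV[OF D(1)[OF xyz(1)]] unfolding C_def by blast
qed

text \<open>Four colour classes together have at most \<open>4 * m\<close> vertices, so each colour
  has a detour meeting \<open>B\<close> in that colour only. Only the colours are required to
  differ, since a single detour that avoids \<open>B\<close> can serve for both.\<close>

lemma clique_points_to_component:
  fixes c :: "'a \<Rightarrow> nat"
  assumes "connected_in (pverts G)"
    and noT: "\<And>F. clique G F \<Longrightarrow> card F \<le> 4 * m \<Longrightarrow> \<exists>p. detour G p \<and> set p \<inter> F = {}"
    and B: "clique G B" "\<forall>b\<in>B. c b < 5" "\<forall>i<5. card {b \<in> B. c b = i} \<le> m"
  shows "\<exists>u i j p q. u \<in> pverts G - B \<and> i \<noteq> j \<and> detour G p \<and> detour G q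
    \<and> set p \<subseteq> component B u \<union> {b \<in> B. c b = i \<and> (\<exists>x\<in>component B u. adj x b)}
    \<and> set q \<subseteq> component B u \<union> {b \<in> B. c b = j \<and> (\<exists>x\<in>component B u. adj x b)}"
proof -
  have finB: "finite B"
    using B(1) pair_finite_verts finite_subset unfolding clique_def by blast
  have "\<exists>p. detour G p \<and> set p \<inter> {b \<in> B. c b \<noteq> i} = {}" if "i < 5" for i
  proof (rule noT)
    show "clique G {b \<in> B. c b \<noteq> i}"
      using B(1) by (rule clique_subset) auto
    have "card {b \<in> B. c b \<noteq> i} \<le> card ({..<5} - {i}) * m"
      by (rule card_le_colour_classes[OF finB B(2,3)]) (use B(2) in auto)
    then show "card {b \<in> B. c b \<noteq> i} \<le> 4 * m"
      using that by simp
  qed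
  then obtain P where det: "\<And>i. i < 5 \<Longrightarrow> detour G (P i)"
    and avoid: "\<And>i. i < 5 \<Longrightarrow> set (P i) \<inter> {b \<in> B. c b \<noteq> i} = {}"
    by metis
  show ?thesis
  proof (cases "\<exists>i<5. set (P i) \<inter> B = {}")
    case True
    then obtain i where i: "i < 5" "set (P i) \<inter> B = {}"
      by blast
    have P: "P i \<noteq> []" "set (P i) \<subseteq> pverts G" "successively adj (P i)"
      using detour_vpath[OF det[OF i(1)]] by (auto simp: vpath_iff)
    have "hd (P i) \<in> pverts G - B"
      using P i(2) hd_in_set by blast
    moreover have "set (P i) \<subseteq> component B (hd (P i))"
      using walk_subset_component[OF P(3,1,2) i(2)] .
    \<comment> \<open>The detour misses \<open>B\<close> and is taken as both \<open>p\<close> and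
      \<open>q\<close>; any two distinct colours will do.\<close>
    moreover have "(0::nat) \<noteq> 1"
      by simp
    ultimately show ?thesis
      using det[OF i(1)] by blast
  next
    case False
    then have meet: "set (P i) \<inter> B \<noteq> {}" if "i < 5" for i
      using that by blast
    have disj: "set (P i) \<inter> set (P j) \<inter> B = {}" if "i < 5" "j < 5" "i \<noteq> j" for i j
      using avoid[OF that(1)] avoid[OF that(2)] that(3) by blast
    obtain u i j where u: "u \<in> pverts G - B" and ij: "i < 5" "j < 5" "i \<noteq> j"
      and sub: "set (P i) \<subseteq> component B u \<union> B" "set (P j) \<subseteq> component B u \<union> B"
      using majority_direction[OF assms(1) B(1), of P, OF det meet disj] by blast
    have *: "set (P k) \<subseteq> component B u \<union> {b \<in> B. c b = k \<and> (\<exists>x\<in>component B u. adj x b)}"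
      if k: "k < 5" "l < 5" "k \<noteq> l" "set (P k) \<subseteq> component B u \<union> B" for k l
    proof -
      obtain b where "b \<in> B" "b \<notin> set (P k)"
        using meet[OF k(2)] disj[OF k(1-3)] by blast
      then have "\<exists>x\<in>component B u. adj x z" if "z \<in> set (P k)" "z \<in> B" for z
        using detour_clique_vertex_adj[OF B(1) det[OF k(1)] _ _ k(4) that] by blast
      then show ?thesis
        using k(4) avoid[OF k(1)] by blast
    qed
    show ?thesis
      using u ij(3) det[OF ij(1)] det[OF ij(2)] *[OF ij(1,2,3) sub(1)] *[OF ij(2,1) ij(3)[symmetric] sub(2)]
      by blast
  qed
qed

text \<open>Induction on \<open>card C\<close>. That every vertex of \<open>B\<close> has a
  neighbour in \<open>C\<close> is part of the invariant because it yields the vertex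
  \<open>v\<close> complete to \<open>B\<close>.\<close>

lemma no_coloured_clique_with_direction:
  fixes c :: "'a \<Rightarrow> nat"
  assumes "chordal G" "connected_in (pverts G)"
    and cl: "\<And>K. clique G K \<Longrightarrow> card K \<le> 5 * m"
    and noT: "\<And>F. clique G F \<Longrightarrow> card F \<le> 4 * m \<Longrightarrow> \<exists>p. detour G p \<and> set p \<inter> F = {}"
    and "clique G B" "\<forall>b\<in>B. c b < 5" "\<forall>i<5. card {b \<in> B. c b = i} \<le> m"
    and "C \<noteq> {}" "C \<subseteq> pverts G" "connected_in C" "cut_off B C" "\<forall>b\<in>B. \<exists>x\<in>C. adj x b"
    and "i \<noteq> j" "detour G p" "detour G q"
    and "set p \<subseteq> C \<union> {b \<in> B. c b = i}" "set q \<subseteq> C \<union> {b \<in> B. c b = j}"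
  shows False
  using assms(5-)
proof (induct "card C" arbitrary: B c C i j p q rule: less_induct)
  case less
  note B = less.prems(1-3) and C = less.prems(4-8) and ij = less.prems(9) and det = less.prems(10,11)
    and sub = less.prems(12,13)
  have finB: "finite B" and finC: "finite C"
    using B(1) C(2) pair_finite_verts finite_subset unfolding clique_def by blast+
  have CB: "C \<inter> B = {}"
    using C(4) by (simp add: cut_off_def)
  obtain v where v: "v \<in> C" "\<forall>b\<in>B. adj v b"
    using exists_vertex_complete_to_clique[OF assms(1) B(1) C(1,2) CB C(3,5)] by blast
  have vB: "v \<notin> B"
    using v(1) CB by blast
  have B': "clique G (insert v B)"
  proof -
    have "\<forall>b\<in>B. adj b v"
      using v(2) by (simp add: adj_sym[of _ v])
    then show ?thesis
      using B(1) v C(2) unfolding clique_def by auto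
  qed
  obtain c' where c': "\<forall>b\<in>insert v B. c' b < 5" "\<forall>i<5. card {b \<in> insert v B. c' b = i} \<le> m"
    "\<forall>b\<in>B. c' b = c b"
    by (rule extend_colouring[OF finB vB cl[OF B'] B(2,3)]) (rule that)
  obtain u i' j' p' q' where u: "u \<in> pverts G - insert v B" and ij': "i' \<noteq> j'"
    and det': "detour G p'" "detour G q'"
    and sub0: "set p' \<subseteq> component (insert v B) u
        \<union> {b \<in> insert v B. c' b = i' \<and> (\<exists>x\<in>component (insert v B) u. adj x b)}"
      "set q' \<subseteq> component (insert v B) u
        \<union> {b \<in> insert v B. c' b = j' \<and> (\<exists>x\<in>component (insert v B) u. adj x b)}"
    using clique_points_to_component[OF assms(2) noT B' c'(1,2)] by blast
  define C' where "C' = component (insert v B) u"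
  \<comment> \<open>Discarding the clique vertices without a neighbour in \<open>C'\<close> restores
    the invariant for the pair \<open>S\<close>, \<open>C'\<close>.\<close>
  define S where "S = {b \<in> insert v B. \<exists>x\<in>C'. adj x b}"
  have sub': "set p' \<subseteq> C' \<union> {b \<in> S. c' b = i'}" "set q' \<subseteq> C' \<union> {b \<in> S. c' b = j'}"
    using sub0 unfolding S_def C'_def by auto
  have C': "u \<in> C'" "C' \<subseteq> pverts G - insert v B" "connected_in C'" "cut_off (insert v B) C'"
    unfolding C'_def
    using component_self component_subset[OF u] connected_in_component[OF u] cut_off_component[OF u]
    by blast+
  show False
  proof (cases "C' \<subseteq> C")
    case True
    have "C' \<subset> C"
      using True v(1) C'(2) by blast
    then have "card C' < card C"
      using finC psubset_card_mono by blast
    moreover have "clique G S"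
      using B' by (rule clique_subset) (auto simp: S_def)
    moreover have "\<forall>b\<in>S. c' b < 5"
      using c'(1) by (auto simp: S_def)
    moreover have "card {b \<in> S. c' b = i} \<le> m" if "i < 5" for i
    proof -
      have "card {b \<in> S. c' b = i} \<le> card {b \<in> insert v B. c' b = i}"
        by (rule card_mono) (use finB in \<open>auto simp: S_def\<close>)
      then show ?thesis
        using c'(2) that by fastforce
    qed
    moreover have "C' \<noteq> {}" "C' \<subseteq> pverts G"
      using C'(1,2) by blast+
    moreover have "cut_off S C'"
      using C'(4) unfolding cut_off_def S_def by auto
    moreover have "\<forall>b\<in>S. \<exists>x\<in>C'. adj x b"
      by (simp add: S_def)
    ultimately show False
      using C'(3) ij' det' sub' by (intro less.hyps[of C' S c' i' j' p' q']) auto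
  next
    case False
    \<comment> \<open>\<open>C'\<close> is connected and avoids \<open>B\<close>, so it cannot leave
      \<open>C\<close> once it meets it.\<close>
    have CC': "C' \<inter> C = {}"
    proof (rule ccontr)
      assume "C' \<inter> C \<noteq> {}"
      then obtain x where x: "x \<in> C'" "x \<in> C"
        by blast
      have "y \<in> C" if "y \<in> C'" for y
      proof (rule reach_in_cut_off[OF _ _ C(4) x(2)])
        show "reach_in C' x y"
          using C'(3) x(1) that by (simp add: connected_in_def)
      qed (use C'(2) in auto)
      then show False
        using False by blast
    qed
    \<comment> \<open>All neighbours of \<open>v\<close> are in \<open>C \<union> B\<close>, which
      \<open>C'\<close> misses. Thus \<open>S\<close> lies in \<open>B\<close>, where old and new
      colours agree.\<close>
    have "v \<notin> S"
    proof
      assume "v \<in> S"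
      then obtain x where "x \<in> C'" "adj v x"
        unfolding S_def by (auto simp: adj_sym[of _ v])
      moreover from this have "x \<in> C \<union> B"
        using C(4) v(1) unfolding cut_off_def by blast
      ultimately show False
        using CC' C'(2) by blast
    qed
    then have S: "S \<subseteq> B"
      by (auto simp: S_def)
    have apart: False if ki: "k \<noteq> i" and r: "detour G r" "set r \<subseteq> C' \<union> {b \<in> S. c' b = k}" for k r
    proof -
      have "set p \<inter> set r = {}"
      proof (rule ccontr)
        assume "set p \<inter> set r \<noteq> {}"
        then obtain z where "z \<in> C \<union> {b \<in> B. c b = i}" "z \<in> C' \<union> {b \<in> S. c' b = k}"
          using sub(1) r(2) by blast
        then show False
          using CC' S c'(3) CB C'(2) ki by auto
      qed
      then show False
        using detours_intersect[OF assms(2) det(1) r(1)] by blast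
    qed
    show False
      \<comment> \<open>As \<open>i'\<close> and \<open>j'\<close> differ, one of them differs from
        \<open>i\<close>, and its detour is disjoint from \<open>p\<close>.\<close>
      using apart[OF _ det'(1) sub'(1)] apart[OF _ det'(2) sub'(2)] ij' by blast
  qed
qed

end

section \<open>Starting the descent from the empty clique\<close>

theorem theorem1:
  fixes G :: "'a pair_pre_digraph"
  assumes "pair_graph G"
    and "Digraph_Component.connected (with_proj G)"
    and "chordal G"
  shows "\<exists>F. detour_transversal G F
           \<and> int (card F) \<le> 4 * \<lceil>real (clique_number G) / 5\<rceil>
           \<and> clique G F"
proof (rule ccontr)
  assume none: "\<not> ?thesis"
  interpret pair_graph G
    by (rule assms(1))
  define m where "m = nat \<lceil>real (clique_number G) / 5\<rceil>"
  have m: "int m = \<lceil>real (clique_number G) / 5\<rceil>"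
    by (simp add: m_def)
  have "real (clique_number G) / 5 \<le> real m"
    using le_of_int_ceiling[of "real (clique_number G) / 5"] m by linarith
  then have m5: "clique_number G \<le> 5 * m"
    by linarith
  have "{card K | K. clique G K} \<subseteq> card ` Pow (pverts G)"
    by (auto simp: clique_def)
  then have fin: "finite {card K | K. clique G K}"
    using pair_finite_verts by (simp add: finite_subset)
  have cl: "card K \<le> 5 * m" if "clique G K" for K
  proof -
    have "card K \<le> clique_number G"
      unfolding clique_number_def using that by (intro Max_ge[OF fin]) blast
    then show ?thesis
      using m5 by simp
  qed
  have noT: "\<exists>p. detour G p \<and> set p \<inter> F = {}" if "clique G F" "card F \<le> 4 * m" for F
  proof -
    have "int (card F) \<le> 4 * \<lceil>real (clique_number G) / 5\<rceil>"
      unfolding m[symmetric] using that(2) by linarith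
    then have "\<not> detour_transversal G F"
      using none that(1) by blast
    moreover have "F \<subseteq> pverts G"
      using that(1) by (simp add: clique_def)
    ultimately show ?thesis
      unfolding detour_transversal_def by blast
  qed
  \<comment> \<open>Connectedness is strong connectedness of the symmetric closure, whose arcs are
    those of \<open>G\<close> itself.\<close>
  have sc: "strongly_connected (mk_symmetric G)"
    using assms(2) by (simp add: connected_def)
  then have ne: "pverts G \<noteq> {}"
    by (simp add: strongly_connected_def)
  have sym: "parcs (mk_symmetric G) = parcs G"
    using adj_mk_symmetric_eq pair_sym_arcs by simp
  have conn: "connected_in (pverts G)"
    unfolding connected_in_def
  proof (intro ballI)
    fix x y assume "x \<in> pverts G" "y \<in> pverts G"
    then have "x \<rightarrow>\<^sup>*\<^bsub>with_proj (mk_symmetric G)\<^esub> y"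
      using sc by (simp add: strongly_connected_def)
    from reachable_rtranclI[OF this] have "(x, y) \<in> (parcs G)\<^sup>*"
      by (simp add: sym)
    then show "reach_in (pverts G) x y"
    proof (induct rule: rtrancl_induct)
      case (step y z)
      then show ?case
        using reach_in_trans[OF step(3)] reach_in_step[OF step(2)]
          in_arcsD1[OF step(2)] in_arcsD2[OF step(2)] by blast
    qed (rule reach_in_refl)
  qed
  \<comment> \<open>The empty clique is no transversal either, which supplies a detour. Lying in
    \<open>C = pverts G\<close> with \<open>B\<close> empty, it serves for both colours 0 and
    1.\<close>
  obtain p where p: "detour G p"
    using noT[of "{}"] unfolding clique_def by auto
  then have "set p \<subseteq> pverts G"
    by (auto dest!: detour_vpath simp: vpath_iff)
  moreover have "cut_off {} (pverts G)"
    unfolding cut_off_def by (auto dest: in_arcsD2)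
  moreover have "clique G {}"
    by (simp add: clique_def)
  ultimately show False
    using no_coloured_clique_with_direction[OF assms(3) conn cl noT _ _ _ ne _ conn _ _ zero_neq_one p p,
        of "{}" "\<lambda>_. 0"] by simp
qed

end
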